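(* Monotonic GNNs have exactly the same expressive power as $\exists^+\mathcal{GML}$: for every monotonic GNN $\mathcal{N}$ of dimension $d$ there is an $\exists^+\mathcal{GML}$ formula $\varphi$ over $\mathsf{PROP}=\{p_1,\dots,p_d\}$ such that for all pointed graphs $(G,v)$ of dimension $d$, $\mathcal{N}(G,v)=\mathsf{true}$ iff $(\mathfrak{M}_G,v)\models\varphi$; and conversely, for every $\exists^+\mathcal{GML}$ formula $\varphi$ over $\{p_1,\dots,p_d\}$ there is a monotonic GNN $\mathcal{N}$ of dimension $d$ with the same property.
   Context: Graphs are finite, undirected, simple, node-labelled $G=(V,E,\lambda)$ with $\lambda:V\to\{0,1\}^d$ ($d$ the dimension); a pointed graph is $(G,v)$ with $v\in V$. $G$ corresponds to the Kripke model $\mathfrak{M}_G$ with worlds $V$, accessibility $\{(u,w):\{u,w\}\in E\}$, and $p_i$ true at $u$ iff the $i$-th entry of $\lambda(u)$ is $1$. A GNN of dimension $d$ with $L$ layers consists of layers $(\mathsf{agg}_\ell,\mathsf{comb}_\ell)$, $\ell=1,\dots,L$, where $\mathsf{agg}_\ell$ maps finite multisets of vectors in $\mathbb{R}^{d_{\ell-1}}$ to vectors in $\mathbb{R}^{d'_\ell}$ and $\mathsf{comb}_\ell:\mathbb{R}^{d_{\ell-1}+d'_\ell}\to\mathbb{R}^{d_\ell}$ ($d_0=d$), and a classification function $\mathsf{cls}:\mathbb{R}^{d_L}\to\{\mathsf{false},\mathsf{true}\}$. On $G$: $\lambda^{(0)}=\lambda$ and $\lambda^{(\ell)}(v)=\mathsf{comb}_\ell(\lambda^{(\ell-1)}(v),\mathsf{agg}_\ell(\{\!\{\lambda^{(\ell-1)}(w):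 \{v,w\}\in E\}\!\}))$; $\mathcal{N}(G,v)=\mathsf{cls}(\lambda^{(L)}(v))$. For vectors, $\mathbf{x}\le\mathbf{x}'$ means componentwise $\le$; for multisets $M\le M'$ iff there is an injection $f:M\to M'$ with $\mathbf{x}\le f(\mathbf{x})$ for all $\mathbf{x}\in M$; on truth values $\mathsf{false}\le\mathsf{true}$. A function is non-decreasing if $x\le y$ implies $f(x)\le f(y)$ (and, for combination functions, on concatenated vectors componentwise). A GNN is monotonic if all its aggregation functions, combination functions and its classification function are non-decreasing. $\mathcal{GML}$: $\varphi::=p\mid\neg\varphi\mid\varphi\wedge\varphi\mid\varphi\vee\varphi\mid\Diamond^{\ge k}\varphi$ ($k\ge1$), $(\mathfrak{M},w)\models\Diamond^{\ge k}\varphi$ iff at least $k$ successors of $w$ satisfy $\varphi$; $\exists^+\mathcal{GML}$ is its negation-free fragment.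
   Formalization: The negation-free fragment is taken with the truth constants ⊤ and ⊥, since without them constant GNNs (which are monotonic) have no equivalent formula; graphs have nodes from one arbitrary fixed set (e.g. the naturals, covering all finite graphs up to isomorphism). *)

theory Defs
  imports "Jordan_Normal_Form.Matrix" "HOL-Library.Multiset"
begin

section \<open>Labelled graphs\<close>

text \<open>Edges are unordered pairs; labels are real 0/1-vectors, so that they can be fed
  directly into a GNN.\<close>

record 'v lgraph =
  nodes :: "'v set"
  edges :: "'v set set"
  lab :: "'v \<Rightarrow> real vec"

definition is_lgraph :: "nat \<Rightarrow> 'v lgraph \<Rightarrow> bool" where
  "is_lgraph d G \<longleftrightarrow>
     finite (nodes G) \<and>
     (\<forall>e \<in> edges G. e \<subseteq> nodes G \<and> card e = 2) \<and>
     (\<forall>v \<in> nodes G. lab G v \<in> carrier_vec d \<and> (\<forall>i < d. lab G v $ i \<in> {0, 1}))"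

definition pointed_lgraph :: "nat \<Rightarrow> 'v lgraph \<Rightarrow> 'v \<Rightarrow> bool" where
  "pointed_lgraph d G v \<longleftrightarrow> is_lgraph d G \<and> v \<in> nodes G"


section \<open>Graph neural networks\<close>

text \<open>Layers are numbered from 1 to \<open>gnn_depth\<close>; layer \<open>l\<close> maps vectors of dimension
  \<open>gnn_dim (l - 1)\<close> to vectors of dimension \<open>gnn_dim l\<close>, and its aggregation function
  has output dimension \<open>gnn_agg_dim l\<close>. A combination function takes the concatenation
  of its two arguments.\<close>

record gnn =
  gnn_depth :: nat
  gnn_dim :: "nat \<Rightarrow> nat"
  gnn_agg_dim :: "nat \<Rightarrow> nat"
  gnn_agg :: "nat \<Rightarrow> real vec multiset \<Rightarrow> real vec"
  gnn_comb :: "nat \<Rightarrow> real vec \<Rightarrow> real vec"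
  gnn_cls :: "real vec \<Rightarrow> bool"

definition vec_msets :: "nat \<Rightarrow> real vec multiset set" where
  "vec_msets n = {M. set_mset M \<subseteq> carrier_vec n}"

definition is_gnn :: "nat \<Rightarrow> gnn \<Rightarrow> bool" where
  "is_gnn d N \<longleftrightarrow>
     gnn_dim N 0 = d \<and>
     (\<forall>l \<in> {1..gnn_depth N}.
        gnn_agg N l \<in> vec_msets (gnn_dim N (l - 1)) \<rightarrow> carrier_vec (gnn_agg_dim N l) \<and>
        gnn_comb N l \<in> carrier_vec (gnn_dim N (l - 1) + gnn_agg_dim N l)
                         \<rightarrow> carrier_vec (gnn_dim N l))"

primrec gnn_lab :: "gnn \<Rightarrow> 'v lgraph \<Rightarrow> nat \<Rightarrow> 'v \<Rightarrow> real vec" where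
  "gnn_lab N G 0 v = lab G v"
| "gnn_lab N G (Suc l) v =
     gnn_comb N (Suc l)
       (gnn_lab N G l v @\<^sub>v
        gnn_agg N (Suc l) (image_mset (gnn_lab N G l) (mset_set {w. {v, w} \<in> edges G})))"

definition gnn_run :: "gnn \<Rightarrow> 'v lgraph \<Rightarrow> 'v \<Rightarrow> bool" where
  "gnn_run N G v \<longleftrightarrow> gnn_cls N (gnn_lab N G (gnn_depth N) v)"

text \<open>An injection between multisets is an injection between their sets of occurrences:
  \<open>(x, i)\<close> with \<open>i < count M x\<close> is the \<open>i\<close>-th copy of \<open>x\<close> in \<open>M\<close>.\<close>

definition occs :: "'a multiset \<Rightarrow> ('a \<times> nat) set" where
  "occs M = {(x, i). i < count M x}"

definition mset_le :: "'a::ord multiset \<Rightarrow> 'a multiset \<Rightarrow> bool" where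
  "mset_le M M' \<longleftrightarrow>
     (\<exists>f. f \<in> occs M \<rightarrow> occs M' \<and> inj_on f (occs M) \<and> (\<forall>p \<in> occs M. fst p \<le> fst (f p)))"

text \<open>The library order on \<open>real vec\<close> is the componentwise one between vectors of equal
  dimension.\<close>

definition monotonic_gnn :: "gnn \<Rightarrow> bool" where
  "monotonic_gnn N \<longleftrightarrow>
     (\<forall>l \<in> {1..gnn_depth N}.
        monotone_on (vec_msets (gnn_dim N (l - 1))) mset_le (\<le>) (gnn_agg N l) \<and>
        mono_on (carrier_vec (gnn_dim N (l - 1) + gnn_agg_dim N l)) (gnn_comb N l)) \<and>
     mono_on (carrier_vec (gnn_dim N (gnn_depth N))) (gnn_cls N)"


section \<open>Graded modal logic\<close>

record 'v kripke =
  worlds :: "'v set"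
  access :: "('v \<times> 'v) set"
  holds :: "nat \<Rightarrow> 'v \<Rightarrow> bool"

text \<open>Vector entries are indexed from 0, propositions from 1.\<close>

definition kripke_of :: "'v lgraph \<Rightarrow> 'v kripke" where
  "kripke_of G =
     \<lparr>worlds = nodes G,
      access = {(u, w). {u, w} \<in> edges G},
      holds = (\<lambda>i u. lab G u $ (i - 1) = 1)\<rparr>"

text \<open>The constants are atoms here because they are not definable from propositions
  without negation. The negation-free fragment needs both of them: without \<open>Bot\<close> every
  negation-free formula holds at a node of a large enough complete graph with all labels 1,
  and without \<open>Top\<close> none holds at an isolated node with label 0, so the two constant
  GNNs (which are monotonic) would have no equivalent formula.\<close>

datatype gml =
    Prop nat
  | Top
  | Bot
  | Neg gml
  | Conj gml gml
  | Disj gml gml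
  | Dia nat gml

primrec gml_over :: "nat \<Rightarrow> gml \<Rightarrow> bool" where
  "gml_over d (Prop i) \<longleftrightarrow> i \<in> {1..d}"
| "gml_over d Top \<longleftrightarrow> True"
| "gml_over d Bot \<longleftrightarrow> True"
| "gml_over d (Neg \<phi>) \<longleftrightarrow> gml_over d \<phi>"
| "gml_over d (Conj \<phi> \<psi>) \<longleftrightarrow> gml_over d \<phi> \<and> gml_over d \<psi>"
| "gml_over d (Disj \<phi> \<psi>) \<longleftrightarrow> gml_over d \<phi> \<and> gml_over d \<psi>"
| "gml_over d (Dia k \<phi>) \<longleftrightarrow> k \<ge> 1 \<and> gml_over d \<phi>"

primrec neg_free :: "gml \<Rightarrow> bool" where
  "neg_free (Prop i) \<longleftrightarrow> True"
| "neg_free Top \<longleftrightarrow> True"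
| "neg_free Bot \<longleftrightarrow> True"
| "neg_free (Neg \<phi>) \<longleftrightarrow> False"
| "neg_free (Conj \<phi> \<psi>) \<longleftrightarrow> neg_free \<phi> \<and> neg_free \<psi>"
| "neg_free (Disj \<phi> \<psi>) \<longleftrightarrow> neg_free \<phi> \<and> neg_free \<psi>"
| "neg_free (Dia k \<phi>) \<longleftrightarrow> neg_free \<phi>"

definition ex_pos_gml :: "nat \<Rightarrow> gml set" where
  "ex_pos_gml d = {\<phi>. gml_over d \<phi> \<and> neg_free \<phi>}"

primrec sat :: "'v kripke \<Rightarrow> 'v \<Rightarrow> gml \<Rightarrow> bool" where
  "sat M w (Prop i) \<longleftrightarrow> holds M i w"
| "sat M w Top \<longleftrightarrow> True"
| "sat M w Bot \<longleftrightarrow> False"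
| "sat M w (Neg \<phi>) \<longleftrightarrow> \<not> sat M w \<phi>"
| "sat M w (Conj \<phi> \<psi>) \<longleftrightarrow> sat M w \<phi> \<and> sat M w \<psi>"
| "sat M w (Disj \<phi> \<psi>) \<longleftrightarrow> sat M w \<phi> \<or> sat M w \<psi>"
| "sat M w (Dia k \<phi>) \<longleftrightarrow>
     (\<exists>U. finite U \<and> card U = k \<and> (\<forall>u \<in> U. (w, u) \<in> access M \<and> sat M u \<phi>))"

end

theory Submission
  imports Defs "HOL-Library.Sublist" "HOL-Library.Ramsey"
begin

text \<open>A monotonic GNN with \<open>L\<close> layers is monotone for the depth-\<open>L\<close> graded simulation
  preorder (each node's neighbours are mapped injectively to simulating neighbours). By
  Higman's lemma this preorder on pointed graphs of dimension \<open>d\<close> is a well-quasi-order, so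
  the accepted pointed graphs are the upward closure of finitely many of them. The upward
  closure of one pointed graph is definable by a negation-free formula: by Hall's theorem
  the injection exists iff for every set \<open>S\<close> of neighbours at least \<open>|S|\<close> nodes
  simulate some member of \<open>S\<close>. Conversely, a GNN evaluates a formula by
  computing the truth values of its subformulas one layer at a time.\<close>


section \<open>Almost full relations and Higman's lemma\<close>

text \<open>Over an infinite node type degrees are unbounded, so pointed graphs fall into infinitely
  many types already at depth 1, and since aggregation functions are arbitrary nothing in the
  network bounds the grades that a formula needs. A disjunction over all accepted types would be
  infinite; finiteness has to come from a finite basis of an upward closed set. The basis is
  obtained by contradiction, without any bound on its size or on the grades. In the other direction,
  monotonicity must hold on all real vectors of the right dimension, not only on the 0/1 vectors
  that occur in runs; this is why truth values are tested by \<open>1 \<le>\<close> and never by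
  equality.\<close>

definition almost_full_on :: "('a \<Rightarrow> 'a \<Rightarrow> bool) \<Rightarrow> 'a set \<Rightarrow> bool" where
  "almost_full_on P A \<longleftrightarrow> (\<forall>f :: nat \<Rightarrow> 'a. (\<forall>n. f n \<in> A) \<longrightarrow> (\<exists>i j. i < j \<and> P (f i) (f j)))"

lemma almost_full_onD:
  assumes "almost_full_on P A" and "\<And>n :: nat. f n \<in> A"
  obtains i j where "i < j" and "P (f i) (f j)"
  using assms unfolding almost_full_on_def by blast

text \<open>Almost fullness does not include transitivity, so an infinite chain comes from Ramsey's
  theorem for pairs: a homogeneous set of the other colour would yield an infinite bad
  sequence.\<close>

lemma almost_full_on_homogeneous:
  assumes af: "almost_full_on P A" and f: "\<And>n :: nat. f n \<in> A"
  shows "\<exists>r :: nat \<Rightarrow> nat. strict_mono r \<and> (\<forall>i j. i < j \<longrightarrow> P (f (r i)) (f (r j)))"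
proof -
  \<comment> \<open>Ramsey's theorem colours unordered pairs; \<open>Min\<close> and
    \<open>Max\<close> recover which index comes first.\<close>
  define c where "c X = (if P (f (Min X)) (f (Max X)) then 0 else 1 :: nat)" for X
  have "\<exists>Y t. Y \<subseteq> UNIV \<and> infinite Y \<and> t < 2 \<and> (\<forall>x\<in>Y. \<forall>y\<in>Y. x \<noteq> y \<longrightarrow> c {x, y} = t)"
    by (rule Ramsey2) (auto simp: c_def)
  then obtain Y t where Y: "infinite Y" and t: "\<forall>x\<in>Y. \<forall>y\<in>Y. x \<noteq> y \<longrightarrow> c {x, y} = t"
    by (elim exE conjE)
  define r where "r = enumerate Y"
  have r: "strict_mono r"
    using Y by (simp add: r_def strict_mono_enumerate)
  have rt: "c {r i, r j} = t" if "i < j" for i j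
  proof (rule t[rule_format])
    show "r i \<in> Y" "r j \<in> Y"
      using Y by (simp_all add: r_def enumerate_in_set)
    show "r i \<noteq> r j"
      using strict_monoD[OF r that] by simp
  qed
  have c: "c {r i, r j} = (if P (f (r i)) (f (r j)) then 0 else 1)" if "i < j" for i j
    using strict_monoD[OF r that] by (simp add: c_def)
  obtain i j where "i < j" "P (f (r i)) (f (r j))"
    by (rule almost_full_onD[OF af, of "\<lambda>n. f (r n)"]) (use f in auto)
  then have "t = 0"
    using rt c by metis
  then have "P (f (r i)) (f (r j))" if "i < j" for i j
    using rt[OF that] c[OF that] by (simp split: if_splits)
  with r show ?thesis
    by blast
qed

lemma almost_full_on_finite:
  assumes "finite A" and refl: "\<And>x. x \<in> A \<Longrightarrow> P x x"
  shows "almost_full_on P A"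
  unfolding almost_full_on_def
proof (intro allI impI)
  fix f :: "nat \<Rightarrow> 'a"
  assume f: "\<forall>n. f n \<in> A"
  then have "finite (range f)"
    using \<open>finite A\<close> by (meson finite_subset image_subsetI)
  then have "\<not> inj f"
    using finite_imageD infinite_UNIV_nat by blast
  then obtain i j where "i \<noteq> j" "f i = f j"
    by (auto simp: inj_def)
  then show "\<exists>i j. i < j \<and> P (f i) (f j)"
    using f refl by (metis linorder_neqE_nat)
qed

text \<open>Otherwise elements of \<open>U\<close> could be chosen forever, each above none of the
  earlier ones, against almost fullness.\<close>

lemma almost_full_on_finite_basis:
  assumes af: "almost_full_on P A" and UA: "U \<subseteq> A"
  shows "\<exists>B. finite B \<and> B \<subseteq> U \<and> (\<forall>x\<in>U. \<exists>b\<in>B. P b x)"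
proof (rule ccontr)
  assume contra: "\<nexists>B. finite B \<and> B \<subseteq> U \<and> (\<forall>x\<in>U. \<exists>b\<in>B. P b x)"
  have no: "\<exists>x\<in>U. \<forall>b\<in>B. \<not> P b x" if "finite B" "B \<subseteq> U" for B
  proof (rule ccontr)
    assume "\<not> ?thesis"
    then have "\<forall>x\<in>U. \<exists>b\<in>B. P b x"
      by simp
    with contra that show False
      by metis
  qed
  \<comment> \<open>\<open>g n\<close> accumulates the elements chosen so far, from an arbitrary
    finite start; each stage adds one that lies above no member of \<open>g n\<close>.\<close>
  have "\<exists>g. \<forall>n. (finite (g n) \<and> g n \<subseteq> U) \<and> (\<exists>x\<in>U. g (Suc n) = insert x (g n) \<and> (\<forall>b\<in>g n. \<not> P b x))"
  proof (rule dependent_nat_choice)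
    show "\<exists>B. finite B \<and> B \<subseteq> U"
      by blast
  next
    fix B and n :: nat
    assume B: "finite B \<and> B \<subseteq> U"
    then obtain x where "x \<in> U" "\<forall>b\<in>B. \<not> P b x"
      using no by blast
    then show "\<exists>C. (finite C \<and> C \<subseteq> U) \<and> (\<exists>x\<in>U. C = insert x B \<and> (\<forall>b\<in>B. \<not> P b x))"
      using B by (intro exI[of _ "insert x B"]) auto
  qed
  then obtain g where "\<forall>n. (finite (g n) \<and> g n \<subseteq> U) \<and>
      (\<exists>x\<in>U. g (Suc n) = insert x (g n) \<and> (\<forall>b\<in>g n. \<not> P b x))"
    by (elim exE)
  then have "\<forall>n. \<exists>x. x \<in> U \<and> g (Suc n) = insert x (g n) \<and> (\<forall>b\<in>g n. \<not> P b x)"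
    by (simp add: Bex_def)
  then have "\<exists>x. \<forall>n. x n \<in> U \<and> g (Suc n) = insert (x n) (g n) \<and> (\<forall>b\<in>g n. \<not> P b (x n))"
    by (rule choice)
  then obtain x where "\<forall>n. x n \<in> U \<and> g (Suc n) = insert (x n) (g n) \<and> (\<forall>b\<in>g n. \<not> P b (x n))"
    by (elim exE)
  then have x: "\<And>n. x n \<in> U" "\<And>n. g (Suc n) = insert (x n) (g n)"
      "\<And>n b. b \<in> g n \<Longrightarrow> \<not> P b (x n)"
    by simp_all
  have mono: "g m \<subseteq> g n" if "m \<le> n" for m n
    using x(2) by (intro lift_Suc_mono_le[OF _ that]) auto
  obtain i j where ij: "i < j" "P (x i) (x j)"
    by (rule almost_full_onD[OF af, of x]) (use x(1) UA in auto)
  have "x i \<in> g j"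
    using mono[of "Suc i" j] ij(1) x(2) by auto
  with x(3) ij(2) show False
    by blast
qed

text \<open>Nash-Williams' minimal bad sequence argument.\<close>

lemma almost_full_on_list_emb:
  assumes af: "almost_full_on P A"
  shows "almost_full_on (list_emb P) (lists A)"
proof (rule ccontr)
  define bad where
    "bad f \<longleftrightarrow> (\<forall>n. f n \<in> lists A) \<and> (\<forall>i j. i < j \<longrightarrow> \<not> list_emb P (f i) (f j))" for f :: "nat \<Rightarrow> 'a list"
  \<comment> \<open>Bad sequences are minimised one position at a time: \<open>f n\<close> is
    shortest among the \<open>n\<close>-th entries of the bad sequences that agree with
    \<open>f\<close> before \<open>n\<close>.\<close>
  define minimal where
    "minimal n f \<longleftrightarrow> bad f \<and> (\<forall>h. bad h \<longrightarrow> (\<forall>i<n. h i = f i) \<longrightarrow> length (f n) \<le> length (h n))" for n f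
  assume "\<not> almost_full_on (list_emb P) (lists A)"
  then obtain f0 where f0: "bad f0"
    unfolding almost_full_on_def bad_def by blast
  have ex_minimal: "\<exists>h. minimal n h \<and> (\<forall>i<n. h i = f i)" if "bad f" for n f
  proof -
    let ?Q = "\<lambda>h. bad h \<and> (\<forall>i<n. h i = f i)"
    have "?Q f"
      using that by blast
    then have "\<exists>h. ?Q h \<and> (\<forall>h'. ?Q h' \<longrightarrow> length (h n) \<le> length (h' n))"
      using ex_has_least_nat[of ?Q f "\<lambda>h. length (h n)"] by blast
    then obtain h where h: "?Q h" "\<And>h'. ?Q h' \<Longrightarrow> length (h n) \<le> length (h' n)"
      by blast
    then have "minimal n h"
      unfolding minimal_def by metis
    with h(1) show ?thesis
      by blast
  qed
  have "\<exists>g. \<forall>n. minimal n (g n) \<and> (\<forall>i<Suc n. g (Suc n) i = g n i)"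
  proof (rule dependent_nat_choice)
    show "\<exists>h. minimal 0 h"
      using ex_minimal[OF f0] by blast
  next
    fix h and n :: nat
    assume "minimal n h"
    then show "\<exists>h'. minimal (Suc n) h' \<and> (\<forall>i<Suc n. h' i = h i)"
      using ex_minimal unfolding minimal_def[of n] by blast
  qed
  then obtain g where min: "\<And>n. minimal n (g n)" and Suc: "\<And>n i. i < Suc n \<Longrightarrow> g (Suc n) i = g n i"
    by blast
  \<comment> \<open>The diagonal: position \<open>n\<close> never changes after stage
    \<open>n\<close>, so \<open>m\<close> agrees with \<open>g n\<close> up to \<open>n\<close> and
    inherits badness.\<close>
  define m where "m n = g n n" for n
  have m: "g n i = m i" if "i \<le> n" for i n
    using that by (induction rule: dec_induct) (simp_all add: m_def Suc)
  have bad_g: "bad (g n)" for n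
    using min by (simp add: minimal_def)
  have bad_m: "bad m"
    unfolding bad_def
  proof (intro conjI allI impI)
    show "m n \<in> lists A" for n
      using bad_g by (simp add: bad_def m_def)
    show "\<not> list_emb P (m i) (m j)" if "i < j" for i j
      using bad_g[of j] that m[of i j] m[of j j] unfolding bad_def by (metis less_imp_le order_refl)
  qed
  have min_m: "length (m n) \<le> length (h n)" if "bad h" "\<And>i. i < n \<Longrightarrow> h i = m i" for h n
  proof -
    have "\<forall>i<n. h i = g n i"
      using that(2) m[of _ n] by (metis less_imp_le)
    then have "length (g n n) \<le> length (h n)"
      using min[of n] that(1) unfolding minimal_def by blast
    then show ?thesis
      by (simp add: m_def)
  qed
  have "m n \<noteq> []" for n
  proof
    assume "m n = []"
    then have "list_emb P (m n) (m (Suc n))"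
      by simp
    with bad_m show False
      by (auto simp: bad_def)
  qed
  moreover define a where "a n = hd (m n)" for n
  moreover define b where "b n = tl (m n)" for n
  ultimately have split: "m n = a n # b n" for n
    by simp
  have in_A: "a n \<in> A" "b n \<in> lists A" for n
    using bad_m split[of n] unfolding bad_def by (metis Cons_in_lists_iff)+
  obtain r :: "nat \<Rightarrow> nat" where r: "strict_mono r" and P_r: "\<forall>i j. i < j \<longrightarrow> P (a (r i)) (a (r j))"
    using almost_full_on_homogeneous[of P A a, OF af in_A(1)] by (elim exE conjE)
  \<comment> \<open>The entries of \<open>m\<close> before \<open>r 0\<close>, followed by the tails
    along the subsequence whose heads form a \<open>P\<close>-chain. This sequence is again bad, yet
    shorter than \<open>m\<close> at position \<open>r 0\<close>.\<close>
  define h where "h i = (if i < r 0 then m i else b (r (i - r 0)))" for i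
  have "bad h"
    unfolding bad_def
  proof (intro conjI allI impI notI)
    show "h n \<in> lists A" for n
      using in_A(2) bad_m by (simp add: h_def bad_def)
  next
    fix i j :: nat
    assume ij: "i < j" and emb: "list_emb P (h i) (h j)"
    consider "j < r 0" | "i < r 0" "r 0 \<le> j" | "r 0 \<le> i"
      by linarith
    then show False
    proof cases
      case 1
      with ij emb bad_m show False
        by (simp add: h_def bad_def)
    next
      case 2
      then have "list_emb P (m i) (m (r (j - r 0)))"
        using emb split[of "r (j - r 0)"] by (simp add: h_def list_emb_Cons)
      moreover have "i < r (j - r 0)"
        using 2(1) strict_mono_less_eq[OF r, of 0 "j - r 0"] by linarith
      ultimately show False
        using bad_m by (simp add: bad_def)
    next
      case 3
      let ?i = "r (i - r 0)" and ?j = "r (j - r 0)"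
      have lt: "i - r 0 < j - r 0"
        using 3 ij by linarith
      have "list_emb P (a ?i # b ?i) (a ?j # b ?j)"
        using emb 3 ij P_r lt by (intro list_emb_Cons2) (simp_all add: h_def)
      then have "list_emb P (m ?i) (m ?j)"
        using split by simp
      moreover have "?i < ?j"
        using strict_monoD[OF r lt] .
      ultimately show False
        using bad_m by (simp add: bad_def)
    qed
  qed
  then have "length (m (r 0)) \<le> length (h (r 0))"
    by (rule min_m) (simp add: h_def)
  also have "\<dots> < length (m (r 0))"
    by (simp add: h_def split)
  finally show False
    by simp
qed

text \<open>Passes from lists to the finite sets that they enumerate: when two heads are matched,
  \<open>y\<close> is a new value of the map because \<open>ys\<close> does not contain it.\<close>

lemma list_emb_imp_inj:
  assumes "list_emb P xs ys" and "distinct xs" and "distinct ys"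
  shows "\<exists>g. inj_on g (set xs) \<and> (\<forall>x\<in>set xs. g x \<in> set ys \<and> P x (g x))"
  using assms
proof induction
  case (list_emb_Nil ys)
  then show ?case
    by simp
next
  case (list_emb_Cons xs ys y)
  then show ?case
    by auto
next
  case (list_emb_Cons2 x y xs ys)
  then obtain g where g: "inj_on g (set xs)" "\<forall>x\<in>set xs. g x \<in> set ys \<and> P x (g x)"
    by auto
  then have "inj_on (g(x := y)) (set (x # xs))"
    using list_emb_Cons2.prems by (auto simp: inj_on_def)
  moreover have "\<forall>z\<in>set (x # xs). (g(x := y)) z \<in> set (y # ys) \<and> P z ((g(x := y)) z)"
    using g(2) \<open>P x y\<close> by simp
  ultimately show ?case
    by blast
qed


section \<open>Hall's marriage theorem\<close>

text \<open>Induction on \<open>I\<close> by the argument of Halmos and Vaughan. A nonempty proper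
  subset \<open>J\<close> without surplus is matched on its own, and the rest outside the union of
  its sets; if all such subsets have surplus, any single choice is safe.\<close>

lemma hall_marriage:
  assumes "finite I" and "\<And>i. i \<in> I \<Longrightarrow> finite (A i)"
    and "\<And>J. J \<subseteq> I \<Longrightarrow> card J \<le> card (\<Union>i\<in>J. A i)"
  shows "\<exists>f. inj_on f I \<and> (\<forall>i\<in>I. f i \<in> A i)"
  using assms
proof (induction I arbitrary: A rule: finite_psubset_induct)
  case (psubset I)
  show ?case
  proof (cases "\<exists>J. J \<subset> I \<and> J \<noteq> {} \<and> card (\<Union>i\<in>J. A i) = card J")
    case True
    then obtain J where J: "J \<subset> I" "J \<noteq> {}" "card (\<Union>i\<in>J. A i) = card J"
      by blast
    let ?U = "\<Union>i\<in>J. A i"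
    obtain f where f: "inj_on f J" "\<forall>i\<in>J. f i \<in> A i"
      using psubset.IH[OF J(1), of A] psubset.prems J(1) by (meson order_trans psubset_imp_subset subsetD)
    have "\<exists>f. inj_on f (I - J) \<and> (\<forall>i\<in>I - J. f i \<in> A i - ?U)"
    proof (rule psubset.IH)
      show "I - J \<subset> I"
        using J by blast
      show "finite (A i - ?U)" if "i \<in> I - J" for i
        using that psubset.prems(1) by blast
      \<comment> \<open>Hall's condition for \<open>K \<union> J\<close>, less the tight count of
        \<open>J\<close>.\<close>
      show "card K \<le> card (\<Union>i\<in>K. A i - ?U)" if K: "K \<subseteq> I - J" for K
      proof -
        have KJ: "K \<union> J \<subseteq> I"
          using K J(1) by blast
        have finKJ: "finite K" "finite J"
          using KJ psubset.hyps by (auto intro: finite_subset)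
        have "card K + card J = card (K \<union> J)"
          using K finKJ by (subst card_Un_disjoint) auto
        also have "\<dots> \<le> card (\<Union>i\<in>K \<union> J. A i)"
          using psubset.prems(2)[OF KJ] .
        also have "(\<Union>i\<in>K \<union> J. A i) = (\<Union>i\<in>K. A i - ?U) \<union> ?U"
          by blast
        also have "card \<dots> \<le> card (\<Union>i\<in>K. A i - ?U) + card ?U"
          by (rule card_Un_le)
        finally show ?thesis
          using J(3) by simp
      qed
    qed
    then obtain g where g: "inj_on g (I - J)" "\<forall>i\<in>I - J. g i \<in> A i - ?U"
      by blast
    have "f j \<noteq> g i" if "j \<in> J" "i \<in> I - J" for i j
    proof -
      have "f j \<in> ?U" "g i \<notin> ?U"
        using bspec[OF f(2) that(1)] bspec[OF g(2) that(2)] that(1) by auto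
      then show ?thesis
        by metis
    qed
    then have "inj_on (\<lambda>i. if i \<in> J then f i else g i) I"
      using inj_onD[OF f(1)] inj_onD[OF g(1)] by (intro inj_onI) (auto split: if_splits dest: sym)
    moreover have "\<forall>i\<in>I. (if i \<in> J then f i else g i) \<in> A i"
      using f(2) g(2) by simp
    ultimately show ?thesis
      by (intro exI[of _ "\<lambda>i. if i \<in> J then f i else g i"]) blast
  next
    case False
    have strict: "card J < card (\<Union>i\<in>J. A i)" if J: "J \<subset> I" "J \<noteq> {}" for J
    proof -
      have "card J \<noteq> card (\<Union>i\<in>J. A i)"
        using False J by metis
      moreover have "card J \<le> card (\<Union>i\<in>J. A i)"
        using J(1) by (intro psubset.prems(2)) simp
      ultimately show ?thesis
        by linarith
    qed
    show ?thesis
    proof (cases "I = {}")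
      case True
      then show ?thesis
        by simp
    next
      case nonempty: False
      then obtain i where i: "i \<in> I"
        by blast
      then have "A i \<noteq> {}"
        using psubset.prems(2)[of "{i}"] by auto
      then obtain a where a: "a \<in> A i"
        by blast
      \<comment> \<open>Deleting \<open>a\<close> costs each union at most one element, which the
        strict surplus absorbs.\<close>
      have "\<exists>f. inj_on f (I - {i}) \<and> (\<forall>k\<in>I - {i}. f k \<in> A k - {a})"
      proof (rule psubset.IH)
        show "I - {i} \<subset> I"
          using i by blast
        show "finite (A k - {a})" if "k \<in> I - {i}" for k
          using that psubset.prems(1) by blast
        show "card K \<le> card (\<Union>k\<in>K. A k - {a})" if K: "K \<subseteq> I - {i}" for K
        proof (cases "K = {}")
          case False
          then have "card K < card (\<Union>k\<in>K. A k)"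
            using K i by (intro strict) auto
          moreover have "(\<Union>k\<in>K. A k - {a}) = (\<Union>k\<in>K. A k) - {a}"
            by blast
          moreover have "card (\<Union>k\<in>K. A k) - 1 \<le> card ((\<Union>k\<in>K. A k) - {a})"
            by (simp add: card_Diff_singleton_if)
          ultimately show ?thesis
            by simp
        qed simp
      qed
      then obtain f where f: "inj_on f (I - {i})" "\<forall>k\<in>I - {i}. f k \<in> A k - {a}"
        by blast
      then have "inj_on (f(i := a)) I"
        by (auto simp: inj_on_def split: if_splits)
      moreover have "\<forall>k\<in>I. (f(i := a)) k \<in> A k"
        using f(2) a by simp
      ultimately show ?thesis
        by blast
    qed
  qed
qed


section \<open>Graded simulations\<close>

definition nbrs :: "'v lgraph \<Rightarrow> 'v \<Rightarrow> 'v set" where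
  "nbrs G v = {w. {v, w} \<in> edges G}"

definition true_props :: "nat \<Rightarrow> 'v lgraph \<Rightarrow> 'v \<Rightarrow> nat set" where
  "true_props d G v = {i. i < d \<and> lab G v $ i = 1}"

text \<open>\<open>w\<close> may have further neighbours, since the order on multisets asks only for
  an injection. Depth \<open>l\<close> is what controls the labels after \<open>l\<close>
  layers.\<close>

primrec sim :: "nat \<Rightarrow> nat \<Rightarrow> 'v lgraph \<Rightarrow> 'v \<Rightarrow> 'v lgraph \<Rightarrow> 'v \<Rightarrow> bool" where
  "sim d 0 G v H w \<longleftrightarrow> true_props d G v \<subseteq> true_props d H w"
| "sim d (Suc l) G v H w \<longleftrightarrow> true_props d G v \<subseteq> true_props d H w \<and>
     (\<exists>f. inj_on f (nbrs G v) \<and> (\<forall>u\<in>nbrs G v. f u \<in> nbrs H w \<and> sim d l G u H (f u)))"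

lemma finite_nbrs:
  assumes "is_lgraph d G"
  shows "finite (nbrs G v)"
proof (rule finite_subset)
  show "nbrs G v \<subseteq> nodes G"
    using assms by (fastforce simp: is_lgraph_def nbrs_def)
  show "finite (nodes G)"
    using assms by (simp add: is_lgraph_def)
qed

lemma pointed_nbrs:
  assumes "is_lgraph d G" and "w \<in> nbrs G v"
  shows "pointed_lgraph d G w"
  using assms by (fastforce simp: pointed_lgraph_def is_lgraph_def nbrs_def)

lemma sat_Dia_iff:
  assumes "is_lgraph d G"
  shows "sat (kripke_of G) v (Dia k \<phi>) \<longleftrightarrow> k \<le> card {u \<in> nbrs G v. sat (kripke_of G) u \<phi>}"
proof -
  have fin: "finite {u \<in> nbrs G v. sat (kripke_of G) u \<phi>}"
    using finite_nbrs[OF assms] by simp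
  have "sat (kripke_of G) v (Dia k \<phi>) \<longleftrightarrow> (\<exists>U \<subseteq> {u \<in> nbrs G v. sat (kripke_of G) u \<phi>}. finite U \<and> card U = k)"
    by (auto simp: kripke_of_def nbrs_def)
  also have "\<dots> \<longleftrightarrow> k \<le> card {u \<in> nbrs G v. sat (kripke_of G) u \<phi>}"
  proof
    assume "\<exists>U \<subseteq> {u \<in> nbrs G v. sat (kripke_of G) u \<phi>}. finite U \<and> card U = k"
    then show "k \<le> card {u \<in> nbrs G v. sat (kripke_of G) u \<phi>}"
      using card_mono[OF fin] by auto
  next
    assume "k \<le> card {u \<in> nbrs G v. sat (kripke_of G) u \<phi>}"
    then show "\<exists>U \<subseteq> {u \<in> nbrs G v. sat (kripke_of G) u \<phi>}. finite U \<and> card U = k"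
      by (rule obtain_subset_with_card_n) blast
  qed
  finally show ?thesis .
qed

text \<open>A combination function also reads the node's own previous label, so the same pair must
  be comparable at one depth less. The injections are kept and their depth is lowered
  recursively.\<close>

lemma sim_Suc_imp_sim: "sim d (Suc l) G v H w \<Longrightarrow> sim d l G v H w"
proof (induction l arbitrary: v w)
  case 0
  then show ?case
    by simp
next
  case (Suc l)
  from Suc.prems obtain f where f: "inj_on f (nbrs G v)"
      "\<forall>u\<in>nbrs G v. f u \<in> nbrs H w \<and> sim d (Suc l) G u H (f u)"
    unfolding sim.simps(2)[of d "Suc l"] by (elim exE conjE)
  then have "\<forall>u\<in>nbrs G v. f u \<in> nbrs H w \<and> sim d l G u H (f u)"
    using Suc.IH by simp
  moreover have "true_props d G v \<subseteq> true_props d H w"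
    using Suc.prems by simp
  ultimately show ?case
    using f(1) by auto
qed

text \<open>A node at depth \<open>Suc l\<close> amounts to a label set from a finite alphabet and a
  finite list of neighbours compared at depth \<open>l\<close>. A subsequence with increasing label
  sets settles the first part, Higman's lemma the second.\<close>

lemma almost_full_on_sim:
  fixes d l :: nat
  defines "A \<equiv> {p :: 'v lgraph \<times> 'v. pointed_lgraph d (fst p) (snd p)}"
  shows "almost_full_on (\<lambda>p q. sim d l (fst p) (snd p) (fst q) (snd q)) A"
proof (induction l)
  case 0
  show ?case
    unfolding almost_full_on_def
  proof (intro allI impI)
    fix f :: "nat \<Rightarrow> 'v lgraph \<times> 'v"
    have "almost_full_on (\<subseteq>) (Pow {..<d})"
      by (rule almost_full_on_finite) auto
    then obtain i j where "i < j" "true_props d (fst (f i)) (snd (f i)) \<subseteq> true_props d (fst (f j)) (snd (f j))"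
      by (rule almost_full_onD[where f = "\<lambda>n. true_props d (fst (f n)) (snd (f n))"])
        (auto simp: true_props_def)
    then show "\<exists>i j. i < j \<and> sim d 0 (fst (f i)) (snd (f i)) (fst (f j)) (snd (f j))"
      by auto
  qed
next
  case (Suc l)
  let ?P = "\<lambda>p q. sim d l (fst p) (snd p) (fst q) (snd q)"
  show ?case
    unfolding almost_full_on_def
  proof (intro allI impI)
    fix f :: "nat \<Rightarrow> 'v lgraph \<times> 'v"
    assume f: "\<forall>n. f n \<in> A"
    define G where "G n = fst (f n)" for n
    define v where "v n = snd (f n)" for n
    have G: "is_lgraph d (G n)" for n
      using f by (simp add: A_def G_def pointed_lgraph_def)
    have "almost_full_on (\<subseteq>) (Pow {..<d})"
      by (rule almost_full_on_finite) auto
    then have "\<exists>r :: nat \<Rightarrow> nat. strict_mono r \<and>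
        (\<forall>i j. i < j \<longrightarrow> true_props d (G (r i)) (v (r i)) \<subseteq> true_props d (G (r j)) (v (r j)))"
      by (rule almost_full_on_homogeneous[where f = "\<lambda>n. true_props d (G n) (v n)"])
        (auto simp: true_props_def)
    then obtain r :: "nat \<Rightarrow> nat" where r: "strict_mono r"
      and props: "\<forall>i j. i < j \<longrightarrow> true_props d (G (r i)) (v (r i)) \<subseteq> true_props d (G (r j)) (v (r j))"
      by (elim exE conjE)
    \<comment> \<open>Neighbours carry their graph along, so that the lists of all the graphs draw
      on the one set \<open>A\<close> of the induction hypothesis.\<close>
    have "\<forall>n. \<exists>ws. set ws = Pair (G n) ` nbrs (G n) (v n) \<and> distinct ws"
      using finite_nbrs[OF G] by (intro allI finite_distinct_list) simp
    then have "\<exists>ws. \<forall>n. set (ws n) = Pair (G n) ` nbrs (G n) (v n) \<and> distinct (ws n)"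
      by (rule choice)
    then obtain ws where ws: "\<forall>n. set (ws n) = Pair (G n) ` nbrs (G n) (v n) \<and> distinct (ws n)"
      by (elim exE)
    have wsA: "ws n \<in> lists A" for n
    proof -
      have "Pair (G n) ` nbrs (G n) (v n) \<subseteq> A"
        using pointed_nbrs[OF G[of n]] unfolding A_def by (intro image_subsetI) simp
      then show ?thesis
        using ws unfolding in_lists_conv_set by blast
    qed
    obtain i j where ij: "i < j" and emb: "list_emb ?P (ws (r i)) (ws (r j))"
      by (rule almost_full_onD[OF almost_full_on_list_emb[OF Suc.IH], of "\<lambda>n. ws (r n)"])
        (rule wsA)
    have "\<exists>g. inj_on g (set (ws (r i))) \<and> (\<forall>x\<in>set (ws (r i)). g x \<in> set (ws (r j)) \<and> ?P x (g x))"
      by (rule list_emb_imp_inj[OF emb]) (simp_all add: ws)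
    then obtain g where g: "inj_on g (set (ws (r i)))" "\<forall>x\<in>set (ws (r i)). g x \<in> set (ws (r j)) \<and> ?P x (g x)"
      by (elim exE conjE)
    define h where "h u = snd (g (G (r i), u))" for u
    have h: "g (G (r i), u) = (G (r j), h u)" "h u \<in> nbrs (G (r j)) (v (r j))"
      "sim d l (G (r i)) u (G (r j)) (h u)" if u: "u \<in> nbrs (G (r i)) (v (r i))" for u
    proof -
      have *: "g (G (r i), u) \<in> Pair (G (r j)) ` nbrs (G (r j)) (v (r j))" "?P (G (r i), u) (g (G (r i), u))"
        using g(2) u ws by auto
      then show "g (G (r i), u) = (G (r j), h u)" "h u \<in> nbrs (G (r j)) (v (r j))"
        by (auto simp: h_def)
      with *(2) show "sim d l (G (r i)) u (G (r j)) (h u)"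
        by simp
    qed
    have "inj_on h (nbrs (G (r i)) (v (r i)))"
    proof (rule inj_onI)
      fix x y
      assume xy: "x \<in> nbrs (G (r i)) (v (r i))" "y \<in> nbrs (G (r i)) (v (r i))" "h x = h y"
      then have "g (G (r i), x) = g (G (r i), y)"
        by (simp add: h(1))
      moreover have "(G (r i), x) \<in> set (ws (r i))" "(G (r i), y) \<in> set (ws (r i))"
        using xy(1,2) ws by simp_all
      ultimately have "(G (r i), x) = (G (r i), y)"
        by (rule inj_onD[OF g(1)])
      then show "x = y"
        by simp
    qed
    moreover have "true_props d (G (r i)) (v (r i)) \<subseteq> true_props d (G (r j)) (v (r j))"
      using props ij by simp
    ultimately have "sim d (Suc l) (G (r i)) (v (r i)) (G (r j)) (v (r j))"
      using h(2,3) unfolding sim.simps by (intro conjI exI[of _ h] ballI)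
    then show "\<exists>i j. i < j \<and> sim d (Suc l) (fst (f i)) (snd (f i)) (fst (f j)) (snd (f j))"
      using strict_monoD[OF r ij] unfolding G_def v_def by blast
  qed
qed


section \<open>Monotonicity of GNNs with respect to simulations\<close>

text \<open>\<open>mset_le\<close> speaks of occurrences while simulations map nodes; here every
  node receives its own copy of its value. The copy for a new \<open>x\<close> is indexed by the
  number of copies already present.\<close>

lemma occs_image_mset_set_bij:
  assumes "finite X"
  shows "\<exists>e. bij_betw e X (occs (image_mset g (mset_set X))) \<and> (\<forall>x\<in>X. fst (e x) = g x)"
  using assms
proof induction
  case empty
  then show ?case
    by (simp add: occs_def bij_betw_def)
next
  case (insert x X)
  let ?M = "image_mset g (mset_set X)"
  from insert.IH obtain e where e: "bij_betw e X (occs ?M)" "\<forall>x\<in>X. fst (e x) = g x"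
    by (elim exE conjE)
  have occs: "occs (image_mset g (mset_set (insert x X))) = insert (g x, count ?M (g x)) (occs ?M)"
    using insert.hyps by (auto simp: occs_def split: if_splits)
  let ?e = "e(x := (g x, count ?M (g x)))"
  have new: "?e x \<notin> occs ?M"
    by (simp add: occs_def)
  have "bij_betw ?e X (occs ?M)"
    using e(1) insert.hyps by (subst bij_betw_cong[where g = e]) auto
  then have "bij_betw ?e (X \<union> {x}) (occs ?M \<union> {?e x})"
    using insert.hyps new by (subst notIn_Un_bij_betw3[symmetric]) auto
  then have "bij_betw ?e (insert x X) (occs (image_mset g (mset_set (insert x X))))"
    unfolding occs by (simp del: fun_upd_apply) simp
  moreover have "\<forall>y\<in>insert x X. fst (?e y) = g y"
    using e(2) by simp
  ultimately show ?case
    by blast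
qed

text \<open>The witness is \<open>b\<close> after \<open>f\<close> after the inverse of
  \<open>a\<close>, where \<open>a\<close> and \<open>b\<close> enumerate the occurrences by
  nodes.\<close>

lemma mset_le_image_mset_set:
  assumes "finite X" and "finite Y" and f: "inj_on f X" "\<And>x. x \<in> X \<Longrightarrow> f x \<in> Y"
    and le: "\<And>x. x \<in> X \<Longrightarrow> g x \<le> h (f x)"
  shows "mset_le (image_mset g (mset_set X)) (image_mset h (mset_set Y))"
proof -
  obtain a where a: "bij_betw a X (occs (image_mset g (mset_set X)))" "\<forall>x\<in>X. fst (a x) = g x"
    using occs_image_mset_set_bij[OF \<open>finite X\<close>] by blast
  obtain b where b: "bij_betw b Y (occs (image_mset h (mset_set Y)))" "\<forall>y\<in>Y. fst (b y) = h y"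
    using occs_image_mset_set_bij[OF \<open>finite Y\<close>] by blast
  define c where "c p = b (f (inv_into X a p))" for p
  have inv: "inv_into X a p \<in> X" "a (inv_into X a p) = p" if "p \<in> occs (image_mset g (mset_set X))" for p
    using that a(1) by (auto simp: bij_betw_def inv_into_into f_inv_into_f)
  have "c \<in> occs (image_mset g (mset_set X)) \<rightarrow> occs (image_mset h (mset_set Y))"
    using inv(1) f(2) b(1) unfolding c_def by (auto simp: bij_betw_def)
  moreover have "inj_on c (occs (image_mset g (mset_set X)))"
  proof (rule inj_onI)
    fix p q
    assume pq: "p \<in> occs (image_mset g (mset_set X))" "q \<in> occs (image_mset g (mset_set X))" "c p = c q"
    have "inj_on b Y"
      using b(1) by (simp add: bij_betw_def)
    then have "f (inv_into X a p) = f (inv_into X a q)"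
      using pq inv(1) f(2) unfolding c_def by (meson inj_onD)
    then have "inv_into X a p = inv_into X a q"
      using pq inv(1) by (intro inj_onD[OF f(1)]) auto
    then show "p = q"
      using inv(2) pq(1,2) by metis
  qed
  moreover have "fst p \<le> fst (c p)" if p: "p \<in> occs (image_mset g (mset_set X))" for p
  proof -
    have "fst p = g (inv_into X a p)"
      using a(2) inv[OF p] by metis
    also have "\<dots> \<le> h (f (inv_into X a p))"
      using inv(1)[OF p] by (rule le)
    also have "\<dots> = fst (c p)"
      using b(2) f(2) inv(1)[OF p] by (simp add: c_def)
    finally show ?thesis .
  qed
  ultimately show ?thesis
    unfolding mset_le_def by blast
qed

lemma gnn_lab_carrier:
  assumes N: "is_gnn d N" and G: "is_lgraph d G" and "v \<in> nodes G" and "l \<le> gnn_depth N"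
  shows "gnn_lab N G l v \<in> carrier_vec (gnn_dim N l)"
  using assms(3,4)
proof (induction l arbitrary: v)
  case 0
  then show ?case
    using N G by (simp add: is_gnn_def is_lgraph_def)
next
  case (Suc l)
  have "gnn_lab N G l w \<in> carrier_vec (gnn_dim N l)" if "w \<in> nbrs G v" for w
    using Suc.IH[of w] Suc.prems pointed_nbrs[OF G that] by (simp add: pointed_lgraph_def)
  then have M: "image_mset (gnn_lab N G l) (mset_set (nbrs G v)) \<in> vec_msets (gnn_dim N l)"
    using finite_nbrs[OF G] by (auto simp: vec_msets_def)
  have layer: "gnn_agg N (Suc l) \<in> vec_msets (gnn_dim N l) \<rightarrow> carrier_vec (gnn_agg_dim N (Suc l))"
    "gnn_comb N (Suc l) \<in> carrier_vec (gnn_dim N l + gnn_agg_dim N (Suc l)) \<rightarrow> carrier_vec (gnn_dim N (Suc l))"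
    using N Suc.prems(2) unfolding is_gnn_def by force+
  have "gnn_lab N G l v @\<^sub>v gnn_agg N (Suc l) (image_mset (gnn_lab N G l) (mset_set (nbrs G v)))
      \<in> carrier_vec (gnn_dim N l + gnn_agg_dim N (Suc l))"
    using Suc.IH[of v] Suc.prems funcset_mem[OF layer(1) M] by (intro append_carrier_vec) auto
  then show ?case
    using funcset_mem[OF layer(2)] by (simp add: nbrs_def)
qed

lemma gnn_lab_image_mset_carrier:
  assumes "is_gnn d N" and G: "is_lgraph d G" and "l \<le> gnn_depth N"
  shows "image_mset (gnn_lab N G l) (mset_set (nbrs G v)) \<in> vec_msets (gnn_dim N l)"
  using gnn_lab_carrier[OF assms(1,2)] assms(3) finite_nbrs[OF G] pointed_nbrs[OF G]
  by (fastforce simp: vec_msets_def pointed_lgraph_def)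

text \<open>One layer per level of the simulation: the injection between neighbourhoods makes the
  two multisets comparable, and the nodes' own labels are compared at the lower depth.\<close>

lemma gnn_lab_sim_mono:
  assumes N: "is_gnn d N" and mono: "monotonic_gnn N"
    and G: "is_lgraph d G" and H: "is_lgraph d H"
    and "v \<in> nodes G" and "w \<in> nodes H" and "l \<le> gnn_depth N" and "sim d l G v H w"
  shows "gnn_lab N G l v \<le> gnn_lab N H l w"
  using assms(5-)
proof (induction l arbitrary: v w)
  case 0
  then have *: "lab G v \<in> carrier_vec d" "lab H w \<in> carrier_vec d"
    "\<forall>i<d. lab G v $ i \<in> {0, 1}" "\<forall>i<d. lab H w $ i \<in> {0, 1}"
    using G H by (simp_all add: is_lgraph_def)
  \<comment> \<open>Entries are 0 or 1, so inclusion of the true propositions gives the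
    componentwise order.\<close>
  have "lab G v $ i \<le> lab H w $ i" if "i < d" for i
  proof (cases "lab G v $ i = 1")
    case True
    then have "i \<in> true_props d H w"
      using 0 that by (auto simp: true_props_def)
    then show ?thesis
      using True by (simp add: true_props_def)
  next
    case False
    then have "lab G v $ i = 0" "lab H w $ i \<in> {0, 1}"
      using * that by auto
    then show ?thesis
      by auto
  qed
  then show ?case
    using * by (auto simp: less_eq_vec_def)
next
  case (Suc l)
  let ?M = "image_mset (gnn_lab N G l) (mset_set (nbrs G v))"
  let ?M' = "image_mset (gnn_lab N H l) (mset_set (nbrs H w))"
  have l: "l \<le> gnn_depth N" "Suc l \<in> {1..gnn_depth N}"
    using Suc.prems by auto
  from Suc.prems(4) obtain f where f: "inj_on f (nbrs G v)"
      "\<forall>u\<in>nbrs G v. f u \<in> nbrs H w \<and> sim d l G u H (f u)"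
    unfolding sim.simps by (elim exE conjE)
  have "gnn_lab N G l u \<le> gnn_lab N H l (f u)" if "u \<in> nbrs G v" for u
    using f(2) that l(1) pointed_nbrs[OF G that] pointed_nbrs[OF H, of "f u" w]
    by (intro Suc.IH) (auto simp: pointed_lgraph_def)
  then have "mset_le ?M ?M'"
    using f finite_nbrs[OF G] finite_nbrs[OF H] by (intro mset_le_image_mset_set[where f = f]) auto
  moreover have M: "?M \<in> vec_msets (gnn_dim N l)" "?M' \<in> vec_msets (gnn_dim N l)"
    by (rule gnn_lab_image_mset_carrier[OF N _ l(1)], fact)+
  moreover have "monotone_on (vec_msets (gnn_dim N l)) mset_le (\<le>) (gnn_agg N (Suc l))"
    using mono l(2) unfolding monotonic_gnn_def by force
  ultimately have agg: "gnn_agg N (Suc l) ?M \<le> gnn_agg N (Suc l) ?M'"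
    by (simp add: monotone_on_def)
  have lab: "gnn_lab N G l v \<le> gnn_lab N H l w"
    using Suc.prems l(1) sim_Suc_imp_sim by (intro Suc.IH) blast+
  have "gnn_agg N (Suc l) \<in> vec_msets (gnn_dim N l) \<rightarrow> carrier_vec (gnn_agg_dim N (Suc l))"
    using N l(2) unfolding is_gnn_def by force
  then have "gnn_lab N G l v @\<^sub>v gnn_agg N (Suc l) ?M \<in> carrier_vec (gnn_dim N l + gnn_agg_dim N (Suc l))"
    "gnn_lab N H l w @\<^sub>v gnn_agg N (Suc l) ?M' \<in> carrier_vec (gnn_dim N l + gnn_agg_dim N (Suc l))"
    using gnn_lab_carrier[OF N G Suc.prems(1) l(1)] gnn_lab_carrier[OF N H Suc.prems(2) l(1)] M
    by (auto intro!: append_carrier_vec)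
  moreover have "mono_on (carrier_vec (gnn_dim N l + gnn_agg_dim N (Suc l))) (gnn_comb N (Suc l))"
    using mono l(2) unfolding monotonic_gnn_def by force
  ultimately show ?case
    using append_vec_le[of "gnn_lab N G l v" "gnn_dim N l" "gnn_lab N H l w"]
      gnn_lab_carrier[OF N G Suc.prems(1) l(1)] gnn_lab_carrier[OF N H Suc.prems(2) l(1)] lab agg
    by (simp add: monotone_on_def nbrs_def)
qed


section \<open>From monotonic GNNs to formulas\<close>

text \<open>A semantic notion with closure properties, which spares writing out characteristic
  formulas.\<close>

definition definable :: "nat \<Rightarrow> ('v lgraph \<Rightarrow> 'v \<Rightarrow> bool) \<Rightarrow> bool" where
  "definable d Q \<longleftrightarrow>
     (\<exists>\<phi>\<in>ex_pos_gml d. \<forall>G v. pointed_lgraph d G v \<longrightarrow> (Q G v \<longleftrightarrow> sat (kripke_of G) v \<phi>))"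

lemma definableI:
  assumes "\<phi> \<in> ex_pos_gml d"
    and "\<And>G v. pointed_lgraph d G v \<Longrightarrow> Q G v \<longleftrightarrow> sat (kripke_of G) v \<phi>"
  shows "definable d Q"
  using assms unfolding definable_def by blast

lemma definable_cong:
  assumes "definable d Q" and "\<And>G v. pointed_lgraph d G v \<Longrightarrow> Q' G v \<longleftrightarrow> Q G v"
  shows "definable d Q'"
  using assms unfolding definable_def by simp

lemma definable_conj:
  assumes "definable d Q" and "definable d R"
  shows "definable d (\<lambda>G v. Q G v \<and> R G v)"
proof -
  obtain \<phi> \<psi> where "\<phi> \<in> ex_pos_gml d" "\<psi> \<in> ex_pos_gml d"
    and "\<forall>G v. pointed_lgraph d G v \<longrightarrow> (Q G v \<longleftrightarrow> sat (kripke_of G) v \<phi>)"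
    and "\<forall>G v. pointed_lgraph d G v \<longrightarrow> (R G v \<longleftrightarrow> sat (kripke_of G) v \<psi>)"
    using assms unfolding definable_def by (elim bexE)
  then show ?thesis
    by (intro definableI[of "Conj \<phi> \<psi>"]) (auto simp: ex_pos_gml_def)
qed

lemma definable_disj:
  assumes "definable d Q" and "definable d R"
  shows "definable d (\<lambda>G v. Q G v \<or> R G v)"
proof -
  obtain \<phi> \<psi> where "\<phi> \<in> ex_pos_gml d" "\<psi> \<in> ex_pos_gml d"
    and "\<forall>G v. pointed_lgraph d G v \<longrightarrow> (Q G v \<longleftrightarrow> sat (kripke_of G) v \<phi>)"
    and "\<forall>G v. pointed_lgraph d G v \<longrightarrow> (R G v \<longleftrightarrow> sat (kripke_of G) v \<psi>)"
    using assms unfolding definable_def by (elim bexE)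
  then show ?thesis
    by (intro definableI[of "Disj \<phi> \<psi>"]) (auto simp: ex_pos_gml_def)
qed

text \<open>The empty conjunction is where \<open>Top\<close> enters, for instance for a node
  without true propositions.\<close>

lemma definable_ball:
  assumes "finite S" and "\<And>s. s \<in> S \<Longrightarrow> definable d (Q s)"
  shows "definable d (\<lambda>G v. \<forall>s\<in>S. Q s G v)"
  using assms
proof induction
  case empty
  show ?case
    by (rule definableI[of Top]) (simp_all add: ex_pos_gml_def)
next
  case (insert s S)
  then have "definable d (\<lambda>G v. Q s G v \<and> (\<forall>s\<in>S. Q s G v))"
    by (intro definable_conj) auto
  then show ?case
    by simp
qed

text \<open>The empty disjunction is where \<open>Bot\<close> enters: it arises for a network that
  accepts nothing.\<close>

lemma definable_bex:
  assumes "finite S" and "\<And>s. s \<in> S \<Longrightarrow> definable d (Q s)"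
  shows "definable d (\<lambda>G v. \<exists>s\<in>S. Q s G v)"
  using assms
proof induction
  case empty
  show ?case
    by (rule definableI[of Bot]) (simp_all add: ex_pos_gml_def)
next
  case (insert s S)
  then have "definable d (\<lambda>G v. Q s G v \<or> (\<exists>s\<in>S. Q s G v))"
    by (intro definable_disj) auto
  then show ?case
    by simp
qed

lemma definable_card_nbrs_ge:
  assumes "definable d Q" and "k \<ge> 1"
  shows "definable d (\<lambda>G v. k \<le> card {u \<in> nbrs G v. Q G u})"
proof -
  obtain \<phi> where \<phi>: "\<phi> \<in> ex_pos_gml d"
    and sat: "\<forall>G v. pointed_lgraph d G v \<longrightarrow> (Q G v \<longleftrightarrow> sat (kripke_of G) v \<phi>)"
    using assms(1) unfolding definable_def by (elim bexE)
  show ?thesis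
  proof (rule definableI)
    show "Dia k \<phi> \<in> ex_pos_gml d"
      using \<phi> \<open>k \<ge> 1\<close> by (simp add: ex_pos_gml_def)
    fix G :: "'a lgraph" and v
    assume "pointed_lgraph d G v"
    then have G: "is_lgraph d G"
      by (simp add: pointed_lgraph_def)
    have "{u \<in> nbrs G v. Q G u} = {u \<in> nbrs G v. sat (kripke_of G) u \<phi>}"
      using sat pointed_nbrs[OF G] by blast
    then show "k \<le> card {u \<in> nbrs G v. Q G u} \<longleftrightarrow> sat (kripke_of G) v (Dia k \<phi>)"
      using sat_Dia_iff[OF G] by metis
  qed
qed

lemma definable_true_props: "definable d (\<lambda>H w. true_props d G v \<subseteq> true_props d H w)"
proof -
  have "definable d (\<lambda>H w. \<forall>i\<in>true_props d G v. i \<in> true_props d H w)"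
  proof (rule definable_ball)
    show "finite (true_props d G v)"
      by (simp add: true_props_def)
    show "definable d (\<lambda>H w. i \<in> true_props d H w)" if "i \<in> true_props d G v" for i
      using that by (intro definableI[of "Prop (Suc i)"])
        (auto simp: ex_pos_gml_def true_props_def kripke_of_def)
  qed
  then show ?thesis
    by (simp add: subset_iff Ball_def)
qed

text \<open>An injection into the neighbours is not directly expressible by graded modalities; by
  Hall's theorem it is equivalent to one counting condition per set of neighbours.\<close>

lemma sim_Suc_iff_hall:
  assumes G: "is_lgraph d G" and H: "is_lgraph d H"
  shows "sim d (Suc l) G v H w \<longleftrightarrow> true_props d G v \<subseteq> true_props d H w \<and>
    (\<forall>S\<in>Pow (nbrs G v) - {{}}. card S \<le> card {u \<in> nbrs H w. \<exists>x\<in>S. sim d l G x H u})"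
proof -
  have "(\<exists>f. inj_on f (nbrs G v) \<and> (\<forall>u\<in>nbrs G v. f u \<in> nbrs H w \<and> sim d l G u H (f u))) \<longleftrightarrow>
    (\<forall>S\<in>Pow (nbrs G v) - {{}}. card S \<le> card {u \<in> nbrs H w. \<exists>x\<in>S. sim d l G x H u})"
    (is "(\<exists>f. ?inj f) \<longleftrightarrow> ?hall")
  proof
    assume "\<exists>f. ?inj f"
    then obtain f where f: "inj_on f (nbrs G v)" "\<forall>u\<in>nbrs G v. f u \<in> nbrs H w \<and> sim d l G u H (f u)"
      by (elim exE conjE)
    show ?hall
    proof
      fix S
      assume "S \<in> Pow (nbrs G v) - {{}}"
      then have S: "S \<subseteq> nbrs G v"
        by simp
      have "card S = card (f ` S)"
        using inj_on_subset[OF f(1) S] by (simp add: card_image)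
      also have "\<dots> \<le> card {u \<in> nbrs H w. \<exists>x\<in>S. sim d l G x H u}"
        using finite_nbrs[OF H] f(2) S by (intro card_mono) auto
      finally show "card S \<le> card {u \<in> nbrs H w. \<exists>x\<in>S. sim d l G x H u}" .
    qed
  next
    assume hall: ?hall
    have "\<exists>f. inj_on f (nbrs G v) \<and> (\<forall>x\<in>nbrs G v. f x \<in> {u \<in> nbrs H w. sim d l G x H u})"
    proof (rule hall_marriage)
      show "finite (nbrs G v)" "finite {u \<in> nbrs H w. sim d l G x H u}" for x
        using finite_nbrs[OF G] finite_nbrs[OF H] by simp_all
      show "card S \<le> card (\<Union>x\<in>S. {u \<in> nbrs H w. sim d l G x H u})" if "S \<subseteq> nbrs G v" for S
      proof (cases "S = {}")
        case False
        have "(\<Union>x\<in>S. {u \<in> nbrs H w. sim d l G x H u}) = {u \<in> nbrs H w. \<exists>x\<in>S. sim d l G x H u}"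
          by blast
        moreover have "S \<in> Pow (nbrs G v) - {{}}"
          using False that by blast
        ultimately show ?thesis
          using hall by (metis (no_types, lifting))
      qed simp
    qed
    then show "\<exists>f. ?inj f"
      by simp
  qed
  then show ?thesis
    by simp
qed

text \<open>The recursion builds a conjunction of the true propositions and, for every nonempty set
  \<open>S\<close> of neighbours, the modality of grade \<open>card S\<close> applied to the
  disjunction of the depth-\<open>l\<close> formulas of the members of \<open>S\<close>.
  Nonemptiness keeps the grades at least 1.\<close>

lemma definable_sim:
  assumes "is_lgraph d G"
  shows "definable d (sim d l G v)"
proof (induction l arbitrary: v)
  case 0
  show ?case
    by (rule definable_cong[OF definable_true_props]) simp
next
  case (Suc l)
  have "definable d (\<lambda>H w. true_props d G v \<subseteq> true_props d H w \<and>
    (\<forall>S\<in>Pow (nbrs G v) - {{}}. card S \<le> card {u \<in> nbrs H w. \<exists>x\<in>S. sim d l G x H u}))"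
  proof (intro definable_conj definable_true_props definable_ball definable_card_nbrs_ge definable_bex Suc.IH)
    show "finite (Pow (nbrs G v) - {{}})"
      using finite_nbrs[OF assms] by simp
    fix S
    assume "S \<in> Pow (nbrs G v) - {{}}"
    then show "finite S" "card S \<ge> 1"
      using finite_nbrs[OF assms, of v] by (auto simp: Suc_le_eq card_gt_0_iff intro: finite_subset)
  qed
  then show ?case
    by (rule definable_cong) (simp add: sim_Suc_iff_hall[OF assms] pointed_lgraph_def del: sim.simps)
qed

lemma definable_gnn_run:
  assumes N: "is_gnn d N" and mono: "monotonic_gnn N"
  shows "definable d (gnn_run N :: 'v lgraph \<Rightarrow> 'v \<Rightarrow> bool)"
proof -
  let ?L = "gnn_depth N"
  define A where "A = {p :: 'v lgraph \<times> 'v. pointed_lgraph d (fst p) (snd p)}"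
  define U where "U = {p \<in> A. gnn_run N (fst p) (snd p)}"
  have "\<exists>B. finite B \<and> B \<subseteq> U \<and> (\<forall>q\<in>U. \<exists>p\<in>B. sim d ?L (fst p) (snd p) (fst q) (snd q))"
    unfolding U_def A_def by (rule almost_full_on_finite_basis[OF almost_full_on_sim]) auto
  then obtain B where B: "finite B" "B \<subseteq> U" "\<forall>q\<in>U. \<exists>p\<in>B. sim d ?L (fst p) (snd p) (fst q) (snd q)"
    by (elim exE conjE)
  \<comment> \<open>Acceptance is upward closed; the order on truth values is implication.\<close>
  have up: "gnn_run N H w" if "p \<in> U" "pointed_lgraph d H w" "sim d ?L (fst p) (snd p) H w" for p H w
  proof -
    have p: "is_lgraph d (fst p)" "snd p \<in> nodes (fst p)" "gnn_cls N (gnn_lab N (fst p) ?L (snd p))"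
      using that(1) by (simp_all add: U_def A_def pointed_lgraph_def gnn_run_def)
    have q: "is_lgraph d H" "w \<in> nodes H"
      using that(2) by (simp_all add: pointed_lgraph_def)
    have "gnn_lab N (fst p) ?L (snd p) \<le> gnn_lab N H ?L w"
      using gnn_lab_sim_mono[OF N mono p(1) q(1) p(2) q(2) order_refl that(3)] .
    moreover have "mono_on (carrier_vec (gnn_dim N ?L)) (gnn_cls N)"
      using mono by (simp add: monotonic_gnn_def)
    ultimately have "gnn_cls N (gnn_lab N (fst p) ?L (snd p)) \<le> gnn_cls N (gnn_lab N H ?L w)"
      using gnn_lab_carrier[OF N p(1,2) order_refl] gnn_lab_carrier[OF N q order_refl]
      by (simp only: mono_onD)
    then show ?thesis
      using p(3) by (simp add: gnn_run_def)
  qed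
  have "definable d (\<lambda>H w. \<exists>p\<in>B. sim d ?L (fst p) (snd p) H w)"
  proof (rule definable_bex[OF B(1)])
    fix p
    assume "p \<in> B"
    then have "is_lgraph d (fst p)"
      using B(2) by (auto simp: U_def A_def pointed_lgraph_def)
    then show "definable d (sim d ?L (fst p) (snd p))"
      by (rule definable_sim)
  qed
  then show ?thesis
  proof (rule definable_cong)
    fix H :: "'v lgraph" and w
    assume Hw: "pointed_lgraph d H w"
    show "gnn_run N H w \<longleftrightarrow> (\<exists>p\<in>B. sim d ?L (fst p) (snd p) H w)"
    proof
      assume "gnn_run N H w"
      then have "(H, w) \<in> U"
        using Hw by (simp add: U_def A_def)
      then show "\<exists>p\<in>B. sim d ?L (fst p) (snd p) H w"
        using B(3) by force
    next
      assume "\<exists>p\<in>B. sim d ?L (fst p) (snd p) H w"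
      then show "gnn_run N H w"
        using up Hw B(2) by blast
    qed
  qed
qed


section \<open>From formulas to monotonic GNNs\<close>

primrec children :: "gml \<Rightarrow> gml set" where
  "children (Prop i) = {}"
| "children Top = {}"
| "children Bot = {}"
| "children (Neg \<phi>) = {\<phi>}"
| "children (Conj \<phi> \<psi>) = {\<phi>, \<psi>}"
| "children (Disj \<phi> \<psi>) = {\<phi>, \<psi>}"
| "children (Dia k \<phi>) = {\<phi>}"

text \<open>One layer is spent per entry, and a repeated subformula is evaluated again at each
  occurrence.\<close>

primrec postorder :: "gml \<Rightarrow> gml list" where
  "postorder (Prop i) = [Prop i]"
| "postorder Top = [Top]"
| "postorder Bot = [Bot]"
| "postorder (Neg \<phi>) = postorder \<phi> @ [Neg \<phi>]"
| "postorder (Conj \<phi> \<psi>) = (postorder \<phi> @ postorder \<psi>) @ [Conj \<phi> \<psi>]"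
| "postorder (Disj \<phi> \<psi>) = (postorder \<phi> @ postorder \<psi>) @ [Disj \<phi> \<psi>]"
| "postorder (Dia k \<phi>) = postorder \<phi> @ [Dia k \<phi>]"

definition children_first :: "gml list \<Rightarrow> bool" where
  "children_first \<Phi> \<longleftrightarrow> (\<forall>l<length \<Phi>. children (\<Phi> ! l) \<subseteq> set (take l \<Phi>))"

lemma children_first_append:
  assumes "children_first \<Phi>" and "children_first \<Psi>"
  shows "children_first (\<Phi> @ \<Psi>)"
  unfolding children_first_def
proof (intro allI impI)
  fix l
  assume l: "l < length (\<Phi> @ \<Psi>)"
  show "children ((\<Phi> @ \<Psi>) ! l) \<subseteq> set (take l (\<Phi> @ \<Psi>))"
  proof (cases "l < length \<Phi>")
    case True
    then show ?thesis
      using assms(1) by (simp add: children_first_def nth_append)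
  next
    case False
    then have "children (\<Psi> ! (l - length \<Phi>)) \<subseteq> set (take (l - length \<Phi>) \<Psi>)"
      using assms(2) l by (simp add: children_first_def)
    with False show ?thesis
      by (auto simp: nth_append)
  qed
qed

lemma children_first_snoc:
  assumes "children_first \<Phi>" and "children \<phi> \<subseteq> set \<Phi>"
  shows "children_first (\<Phi> @ [\<phi>])"
  using assms by (auto simp: children_first_def nth_append less_Suc_eq)

lemma in_set_postorder: "\<phi> \<in> set (postorder \<phi>)"
  by (cases \<phi>) simp_all

lemma last_postorder: "last (postorder \<phi>) = \<phi>"
  by (cases \<phi>) simp_all

lemma children_first_postorder: "children_first (postorder \<phi>)"
proof (induction \<phi>)
  case (Neg \<phi>)
  then show ?case
    unfolding postorder.simps by (intro children_first_snoc) (simp_all add: in_set_postorder)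
next
  case (Conj \<phi> \<psi>)
  then show ?case
    unfolding postorder.simps
    by (intro children_first_snoc children_first_append) (simp_all add: in_set_postorder)
next
  case (Disj \<phi> \<psi>)
  then show ?case
    unfolding postorder.simps
    by (intro children_first_snoc children_first_append) (simp_all add: in_set_postorder)
next
  case (Dia k \<phi>)
  then show ?case
    unfolding postorder.simps by (intro children_first_snoc) (simp_all add: in_set_postorder)
qed (simp_all add: children_first_def)

lemma postorder_ex_pos_gml:
  assumes "\<phi> \<in> ex_pos_gml d"
  shows "set (postorder \<phi>) \<subseteq> ex_pos_gml d"
  using assms by (induction \<phi>) (auto simp: ex_pos_gml_def)

text \<open>Among several occurrences the first is read: it precedes all others, hence lies in the
  part of the vector that is already computed.\<close>

definition pos :: "gml list \<Rightarrow> gml \<Rightarrow> nat" where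
  "pos \<Phi> \<phi> = (LEAST j. j < length \<Phi> \<and> \<Phi> ! j = \<phi>)"

lemma pos_take:
  assumes "\<phi> \<in> set (take l \<Phi>)"
  shows "pos \<Phi> \<phi> < l" and "\<Phi> ! pos \<Phi> \<phi> = \<phi>"
proof -
  obtain j where j: "j < l" "j < length \<Phi> \<and> \<Phi> ! j = \<phi>"
    using assms by (auto simp: in_set_conv_nth)
  show "\<Phi> ! pos \<Phi> \<phi> = \<phi>"
    unfolding pos_def using LeastI[of "\<lambda>j. j < length \<Phi> \<and> \<Phi> ! j = \<phi>", OF j(2)] by simp
  show "pos \<Phi> \<phi> < l"
    unfolding pos_def using Least_le[of "\<lambda>j. j < length \<Phi> \<and> \<Phi> ! j = \<phi>", OF j(2)] j(1) by linarith
qed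

text \<open>Layer \<open>l\<close> appends to the current vector the truth value of the \<open>l\<close>-th formula of a
  list in which subformulas come first. The value of a formula is read off the entries of
  its children and, for modalities, off the number of neighbours satisfying the child, which
  is the only entry produced by aggregation.\<close>

primrec layer_val :: "nat \<Rightarrow> (gml \<Rightarrow> nat) \<Rightarrow> gml \<Rightarrow> real vec \<Rightarrow> real \<Rightarrow> bool" where
  "layer_val d p (Prop i) x c \<longleftrightarrow> 1 \<le> x $ (i - 1)"
| "layer_val d p Top x c \<longleftrightarrow> True"
| "layer_val d p Bot x c \<longleftrightarrow> False"
| "layer_val d p (Neg \<phi>) x c \<longleftrightarrow> False"
| "layer_val d p (Conj \<phi> \<psi>) x c \<longleftrightarrow> 1 \<le> x $ (d + p \<phi>) \<and> 1 \<le> x $ (d + p \<psi>)"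
| "layer_val d p (Disj \<phi> \<psi>) x c \<longleftrightarrow> 1 \<le> x $ (d + p \<phi>) \<or> 1 \<le> x $ (d + p \<psi>)"
| "layer_val d p (Dia k \<phi>) x c \<longleftrightarrow> real k \<le> c"

primrec layer_count :: "nat \<Rightarrow> (gml \<Rightarrow> nat) \<Rightarrow> gml \<Rightarrow> real vec multiset \<Rightarrow> nat" where
  "layer_count d p (Prop i) M = 0"
| "layer_count d p Top M = 0"
| "layer_count d p Bot M = 0"
| "layer_count d p (Neg \<phi>) M = 0"
| "layer_count d p (Conj \<phi> \<psi>) M = 0"
| "layer_count d p (Disj \<phi> \<psi>) M = 0"
| "layer_count d p (Dia k \<phi>) M = size (filter_mset (\<lambda>x. 1 \<le> x $ (d + p \<phi>)) M)"

text \<open>Entries below \<open>d\<close> keep the input label, and entry \<open>d + j\<close>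
  stores the truth value of \<open>\<Phi> ! j\<close>. Layers count from 1 and list positions from
  0, hence \<open>l - 1\<close>. In the concatenated vector the aggregate sits at index
  \<open>d + (l - 1)\<close>, the place where the output stores the new truth value.\<close>

definition network :: "nat \<Rightarrow> gml list \<Rightarrow> gnn" where
  "network d \<Phi> =
     \<lparr>gnn_depth = length \<Phi>,
      gnn_dim = (\<lambda>l. d + l),
      gnn_agg_dim = (\<lambda>l. 1),
      gnn_agg = (\<lambda>l M. vec 1 (\<lambda>_. real (layer_count d (pos \<Phi>) (\<Phi> ! (l - 1)) M))),
      gnn_comb = (\<lambda>l z. vec (d + l) (\<lambda>i. if i < d + (l - 1) then z $ i
         else of_bool (layer_val d (pos \<Phi>) (\<Phi> ! (l - 1)) z (z $ (d + (l - 1)))))),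
      gnn_cls = (\<lambda>x. 1 \<le> x $ (d + (length \<Phi> - 1)))\<rparr>"

lemma is_gnn_network: "is_gnn d (network d \<Phi>)"
  by (auto simp: is_gnn_def network_def)

section \<open>Monotonicity of the network\<close>

lemma occs_eq_Sigma: "occs M = (SIGMA x:set_mset M. {..<count M x})"
  by (auto simp: occs_def intro: count_inI)

lemma size_eq_card_occs: "size M = card (occs M)"
  by (simp add: occs_eq_Sigma size_multiset_overloaded_eq)

text \<open>The injection restricts to the occurrences that satisfy \<open>Q\<close>. The condition
  on \<open>Q\<close> is confined to members of the multisets because the vector order controls an
  entry only below the dimension, which membership fixes.\<close>

lemma mset_le_size_filter_mono:
  assumes "mset_le M M'"
    and up: "\<And>x y. x \<in># M \<Longrightarrow> y \<in># M' \<Longrightarrow> x \<le> y \<Longrightarrow> Q x \<Longrightarrow> Q y"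
  shows "size (filter_mset Q M) \<le> size (filter_mset Q M')"
proof -
  obtain f where f: "f \<in> occs M \<rightarrow> occs M'" "inj_on f (occs M)" "\<forall>p\<in>occs M. fst p \<le> fst (f p)"
    using assms(1) unfolding mset_le_def by (elim exE conjE)
  have occs: "occs (filter_mset Q K) = {p \<in> occs K. Q (fst p)}" for K
    by (auto simp: occs_def split: if_splits)
  have mem: "fst p \<in># K" if "p \<in> occs K" for p and K :: "'a multiset"
    using that by (auto simp: occs_eq_Sigma)
  have "finite (occs M')"
    by (simp add: occs_eq_Sigma)
  then have "card (occs (filter_mset Q M)) \<le> card (occs (filter_mset Q M'))"
  proof (intro card_inj_on_le[of f])
    show "inj_on f (occs (filter_mset Q M))"
      using f(2) by (rule inj_on_subset) (auto simp: occs)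
    show "f ` occs (filter_mset Q M) \<subseteq> occs (filter_mset Q M')"
    proof (rule image_subsetI)
      fix p
      assume "p \<in> occs (filter_mset Q M)"
      then have p: "p \<in> occs M" "Q (fst p)"
        by (simp_all add: occs)
      then have fp: "f p \<in> occs M'"
        using f(1) by blast
      then have "Q (fst (f p))"
        using up[OF mem[OF p(1)] mem[OF fp]] f(3) p by blast
      with fp show "f p \<in> occs (filter_mset Q M')"
        by (simp add: occs)
    qed
  qed (simp add: occs)
  then show ?thesis
    by (simp add: size_eq_card_occs)
qed

text \<open>Without negation, entries and counts are only compared with lower thresholds, and such
  tests survive an increase; the bounds on positions keep the entries read inside the
  vector.\<close>

lemma layer_val_mono:
  assumes "\<phi> \<in> ex_pos_gml d" and "\<And>\<psi>. \<psi> \<in> children \<phi> \<Longrightarrow> d + p \<psi> < dim_vec y"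
    and "d \<le> dim_vec y" and "x \<le> y" and "c \<le> c'" and "layer_val d p \<phi> x c"
  shows "layer_val d p \<phi> y c'"
proof -
  have *: "1 \<le> y $ i" if "1 \<le> x $ i" "i < dim_vec y" for i
    using assms(4) that by (force simp: less_eq_vec_def)
  show ?thesis
    using assms by (cases \<phi>) (auto simp: ex_pos_gml_def intro!: *)
qed

lemma layer_count_mono:
  assumes "\<And>\<psi>. \<psi> \<in> children \<phi> \<Longrightarrow> d + p \<psi> < n"
    and "M \<in> vec_msets n" and "M' \<in> vec_msets n" and "mset_le M M'"
  shows "layer_count d p \<phi> M \<le> layer_count d p \<phi> M'"
proof (cases \<phi>)
  case (Dia k \<psi>)
  have "size (filter_mset (\<lambda>x. 1 \<le> x $ (d + p \<psi>)) M) \<le> size (filter_mset (\<lambda>x. 1 \<le> x $ (d + p \<psi>)) M')"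
  proof (rule mset_le_size_filter_mono[OF assms(4)])
    fix x y
    assume "x \<in># M" and y: "y \<in># M'" and le: "x \<le> y" and x: "1 \<le> x $ (d + p \<psi>)"
    have "dim_vec y = n"
      using y assms(3) by (auto simp: vec_msets_def)
    then have "x $ (d + p \<psi>) \<le> y $ (d + p \<psi>)"
      using le assms(1)[of \<psi>] Dia by (simp add: less_eq_vec_def)
    with x show "1 \<le> y $ (d + p \<psi>)"
      by linarith
  qed
  with Dia show ?thesis
    by simp
qed simp_all

lemma monotonic_network:
  assumes \<Phi>: "set \<Phi> \<subseteq> ex_pos_gml d" and cf: "children_first \<Phi>" and "\<Phi> \<noteq> []"
  shows "monotonic_gnn (network d \<Phi>)"
  unfolding monotonic_gnn_def
proof (intro conjI ballI)
  fix l
  assume "l \<in> {1..gnn_depth (network d \<Phi>)}"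
  then obtain m where l: "l = Suc m" "m < length \<Phi>"
    by (cases l) (simp_all add: network_def)
  have pos: "pos \<Phi> \<psi> < m" if "\<psi> \<in> children (\<Phi> ! m)" for \<psi>
    using that cf l(2) by (intro pos_take(1)) (auto simp: children_first_def)
  have \<phi>: "\<Phi> ! m \<in> ex_pos_gml d"
    using \<Phi> l(2) nth_mem by blast
  show "monotone_on (vec_msets (gnn_dim (network d \<Phi>) (l - 1))) mset_le (\<le>) (gnn_agg (network d \<Phi>) l)"
    using layer_count_mono[where n = "d + m" and \<phi> = "\<Phi> ! m" and p = "pos \<Phi>"] pos l(1)
    by (auto simp: monotone_on_def network_def less_eq_vec_def)
  show "mono_on (carrier_vec (gnn_dim (network d \<Phi>) (l - 1) + gnn_agg_dim (network d \<Phi>) l))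
      (gnn_comb (network d \<Phi>) l)"
  proof (rule mono_onI)
    fix x y :: "real vec"
    assume "x \<in> carrier_vec (gnn_dim (network d \<Phi>) (l - 1) + gnn_agg_dim (network d \<Phi>) l)"
      and "y \<in> carrier_vec (gnn_dim (network d \<Phi>) (l - 1) + gnn_agg_dim (network d \<Phi>) l)"
      and le: "x \<le> y"
    then have dim: "dim_vec y = Suc (d + m)"
      by (simp add: network_def l(1))
    have le_i: "x $ i \<le> y $ i" if "i \<le> d + m" for i
      using le dim that by (simp add: less_eq_vec_def)
    have "layer_val d (pos \<Phi>) (\<Phi> ! m) y (y $ (d + m))"
      if "layer_val d (pos \<Phi>) (\<Phi> ! m) x (x $ (d + m))"
      using pos dim by (intro layer_val_mono[OF \<phi> _ _ le le_i[OF order_refl] that]) force+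
    then show "gnn_comb (network d \<Phi>) l x \<le> gnn_comb (network d \<Phi>) l y"
      using le_i by (simp add: network_def l(1) less_eq_vec_def)
  qed
next
  show "mono_on (carrier_vec (gnn_dim (network d \<Phi>) (gnn_depth (network d \<Phi>)))) (gnn_cls (network d \<Phi>))"
  proof (rule mono_onI)
    fix x y :: "real vec"
    assume "y \<in> carrier_vec (gnn_dim (network d \<Phi>) (gnn_depth (network d \<Phi>)))" and le: "x \<le> y"
    \<comment> \<open>For an empty list the classifier would read index \<open>d\<close> of a vector
      of dimension \<open>d\<close>.\<close>
    then have "d + (length \<Phi> - 1) < dim_vec y"
      using \<open>\<Phi> \<noteq> []\<close> by (simp add: network_def)
    then have "x $ (d + (length \<Phi> - 1)) \<le> y $ (d + (length \<Phi> - 1))"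
      using le unfolding less_eq_vec_def by metis
    then show "gnn_cls (network d \<Phi>) x \<le> gnn_cls (network d \<Phi>) y"
      by (auto simp: network_def)
  qed
qed

section \<open>Correctness of the network\<close>

lemma gnn_lab_network:
  assumes \<Phi>: "set \<Phi> \<subseteq> ex_pos_gml d" and cf: "children_first \<Phi>"
    and G: "is_lgraph d G" and "v \<in> nodes G" and "l \<le> length \<Phi>"
  shows "gnn_lab (network d \<Phi>) G l v =
    vec (d + l) (\<lambda>i. if i < d then lab G v $ i else of_bool (sat (kripke_of G) v (\<Phi> ! (i - d))))"
  using assms(4,5)
proof (induction l arbitrary: v)
  case 0
  then show ?case
    using G by (auto simp: is_lgraph_def)
next
  case (Suc l)
  \<comment> \<open>\<open>x u\<close> is the vector that the induction hypothesis gives at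
    \<open>u\<close>. The children of the current formula are among the first \<open>l\<close>
    formulas, so testing their entries against 1 decides their truth.\<close>
  define x where "x u = vec (d + l)
    (\<lambda>i. if i < d then lab G u $ i else of_bool (sat (kripke_of G) u (\<Phi> ! (i - d))) :: real)" for u
  have x: "gnn_lab (network d \<Phi>) G l u = x u" if "u \<in> nodes G" for u
    using Suc.IH[OF that] Suc.prems by (simp add: x_def)
  let ?\<phi> = "\<Phi> ! l" and ?p = "pos \<Phi>"
  define c where "c = real (layer_count d ?p ?\<phi> (image_mset x (mset_set (nbrs G v))))"
  have x_child: "1 \<le> x u $ (d + ?p \<psi>) \<longleftrightarrow> sat (kripke_of G) u \<psi>" "?p \<psi> < l"
    if "\<psi> \<in> children ?\<phi>" for \<psi> u
  proof -
    have "\<psi> \<in> set (take l \<Phi>)"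
      using that cf Suc.prems(2) by (auto simp: children_first_def Suc_le_eq)
    from pos_take[OF this] show "1 \<le> x u $ (d + ?p \<psi>) \<longleftrightarrow> sat (kripke_of G) u \<psi>" "?p \<psi> < l"
      by (simp_all add: x_def)
  qed
  have \<phi>: "?\<phi> \<in> ex_pos_gml d"
    using \<Phi> Suc.prems by (meson Suc_le_lessD nth_mem subsetD)
  have val: "layer_val d ?p ?\<phi> (x v @\<^sub>v vec 1 (\<lambda>_. c)) c \<longleftrightarrow> sat (kripke_of G) v ?\<phi>"
  proof (cases ?\<phi>)
    case (Prop i)
    then have "i - 1 < d"
      using \<phi> by (auto simp: ex_pos_gml_def)
    \<comment> \<open>Labels are 0 or 1, so the threshold test agrees with the valuation, which asks
      for equality with 1.\<close>
    moreover from this have "lab G v $ (i - 1) \<in> {0, 1}"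
      using G Suc.prems(1) by (simp add: is_lgraph_def)
    ultimately show ?thesis
      using Prop by (auto simp: kripke_of_def x_def)
  next
    case (Dia k \<psi>)
    \<comment> \<open>The neighbours whose vector passes the test are those satisfying
      \<open>\<psi>\<close>, with one occurrence per node even where vectors coincide.\<close>
    have "filter_mset (\<lambda>y. 1 \<le> y $ (d + ?p \<psi>)) (image_mset x (mset_set (nbrs G v)))
        = image_mset x (mset_set {u \<in> nbrs G v. sat (kripke_of G) u \<psi>})"
      using x_child(1)[of \<psi>] Dia finite_nbrs[OF G, of v]
      by (simp add: filter_mset_image_mset filter_mset_mset_set)
    then have "c = real (card {u \<in> nbrs G v. sat (kripke_of G) u \<psi>})"
      by (simp add: c_def Dia)
    then show ?thesis
      using sat_Dia_iff[OF G] Dia by (simp del: sat.simps)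
  next
    case (Neg \<psi>)
    then show ?thesis
      using \<phi> by (simp add: ex_pos_gml_def)
  next
    case (Conj \<psi> \<chi>)
    moreover have "dim_vec (x v) = d + l"
      by (simp add: x_def)
    ultimately show ?thesis
      using x_child(1)[of \<psi> v] x_child(2)[of \<psi>] x_child(1)[of \<chi> v] x_child(2)[of \<chi>] by simp
  next
    case (Disj \<psi> \<chi>)
    moreover have "dim_vec (x v) = d + l"
      by (simp add: x_def)
    ultimately show ?thesis
      using x_child(1)[of \<psi> v] x_child(2)[of \<psi>] x_child(1)[of \<chi> v] x_child(2)[of \<chi>] by simp
  qed simp_all
  have "image_mset (gnn_lab (network d \<Phi>) G l) (mset_set (nbrs G v)) = image_mset x (mset_set (nbrs G v))"
    using x pointed_nbrs[OF G] finite_nbrs[OF G]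
    by (intro image_mset_cong) (simp add: pointed_lgraph_def)
  then have "gnn_lab (network d \<Phi>) G (Suc l) v = gnn_comb (network d \<Phi>) (Suc l) (x v @\<^sub>v vec 1 (\<lambda>_. c))"
    using x[OF Suc.prems(1)] by (simp add: network_def c_def nbrs_def)
  also have "\<dots> = vec (d + Suc l)
      (\<lambda>i. if i < d then lab G v $ i else of_bool (sat (kripke_of G) v (\<Phi> ! (i - d))))"
  proof (rule eq_vecI)
    fix i
    assume "i < dim_vec (vec (d + Suc l)
      (\<lambda>i. if i < d then lab G v $ i else of_bool (sat (kripke_of G) v (\<Phi> ! (i - d))) :: real))"
    then consider "i < d + l" | "i = d + l"
      by fastforce
    then show "gnn_comb (network d \<Phi>) (Suc l) (x v @\<^sub>v vec 1 (\<lambda>_. c)) $ i = vec (d + Suc l)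
        (\<lambda>i. if i < d then lab G v $ i else of_bool (sat (kripke_of G) v (\<Phi> ! (i - d)))) $ i"
    proof cases
      case 1
      then show ?thesis
        by (simp add: network_def x_def)
    next
      case 2
      have "(x v @\<^sub>v vec 1 (\<lambda>_. c)) $ (d + l) = c"
        by (simp add: x_def)
      with 2 val show ?thesis
        by (simp add: network_def)
    qed
  qed (simp add: network_def)
  finally show ?case .
qed

lemma gnn_run_network:
  assumes "set \<Phi> \<subseteq> ex_pos_gml d" and "children_first \<Phi>" and "\<Phi> \<noteq> []" and "pointed_lgraph d G v"
  shows "gnn_run (network d \<Phi>) G v \<longleftrightarrow> sat (kripke_of G) v (last \<Phi>)"
proof -
  have "gnn_depth (network d \<Phi>) = length \<Phi>"
    "gnn_cls (network d \<Phi>) = (\<lambda>x. 1 \<le> x $ (d + (length \<Phi> - 1)))"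
    by (simp_all add: network_def)
  then show ?thesis
    using gnn_lab_network[OF assms(1,2), of G v "length \<Phi>"] assms(3,4)
    by (simp add: gnn_run_def pointed_lgraph_def last_conv_nth)
qed


theorem theorem5p5:
  fixes d :: nat
  shows "(\<forall>N. is_gnn d N \<and> monotonic_gnn N \<longrightarrow>
            (\<exists>\<phi> \<in> ex_pos_gml d. \<forall>(G :: 'v lgraph) v. pointed_lgraph d G v \<longrightarrow>
               (gnn_run N G v \<longleftrightarrow> sat (kripke_of G) v \<phi>))) \<and>
         (\<forall>\<phi> \<in> ex_pos_gml d.
            (\<exists>N. is_gnn d N \<and> monotonic_gnn N \<and>
               (\<forall>(G :: 'v lgraph) v. pointed_lgraph d G v \<longrightarrow>
                  (gnn_run N G v \<longleftrightarrow> sat (kripke_of G) v \<phi>))))"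
proof (intro conjI allI impI ballI)
  fix N
  assume "is_gnn d N \<and> monotonic_gnn N"
  then have "definable d (gnn_run N :: 'v lgraph \<Rightarrow> 'v \<Rightarrow> bool)"
    by (intro definable_gnn_run) simp_all
  then show "\<exists>\<phi> \<in> ex_pos_gml d. \<forall>(G :: 'v lgraph) v. pointed_lgraph d G v \<longrightarrow>
      (gnn_run N G v \<longleftrightarrow> sat (kripke_of G) v \<phi>)"
    unfolding definable_def .
next
  fix \<phi>
  assume "\<phi> \<in> ex_pos_gml d"
  then have \<phi>: "set (postorder \<phi>) \<subseteq> ex_pos_gml d"
    by (rule postorder_ex_pos_gml)
  have ne: "postorder \<phi> \<noteq> []"
    using in_set_postorder[of \<phi>] by force
  show "\<exists>N. is_gnn d N \<and> monotonic_gnn N \<and> (\<forall>(G :: 'v lgraph) v. pointed_lgraph d G v \<longrightarrow>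
      (gnn_run N G v \<longleftrightarrow> sat (kripke_of G) v \<phi>))"
  proof (intro exI[of _ "network d (postorder \<phi>)"] conjI allI impI)
    show "is_gnn d (network d (postorder \<phi>))"
      by (rule is_gnn_network)
    show "monotonic_gnn (network d (postorder \<phi>))"
      using \<phi> children_first_postorder ne by (rule monotonic_network)
    show "gnn_run (network d (postorder \<phi>)) G v \<longleftrightarrow> sat (kripke_of G) v \<phi>"
      if "pointed_lgraph d G v" for G :: "'v lgraph" and v
      using gnn_run_network[OF \<phi> children_first_postorder ne that] by (simp add: last_postorder)
  qed
qed

end
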